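(* Let $t$ be a checkers term. (1) Soundness: if $\Gamma\vdash^kt:L$ is derivable, then there exists $k'\le k$ such that $t\Downarrow^{k'}$. (2) Completeness: if $t\Downarrow^k$, then $\Gamma\vdash^kt:L$ is derivable for some environment $\Gamma$ and linear type $L$.
   Context: Checkers terms: $t,u ::= x\mid\lambda_cx.t\mid t\cdot^cu$, $c\in\{\circ,\bullet\}$, modulo $\alpha$. A redex $(\lambda_cx.t)\cdot^du$ contracts to $t\{x:=u\}$; silent if $c=d$, interaction if $c\ne d$. Head contexts $H ::= \lambda_{c_1}x_1\ldots\lambda_{c_n}x_n.(\cdots(\langle\cdot\rangle\cdot^{d_1}t_1)\cdots)\cdot^{d_k}t_k$; checkers head reduction contracts redexes at $H\langle r\rangle$ (deterministic). $t\Downarrow^k$: the head reduction of $t$ reaches a term without head redex, with exactly $k$ interaction head steps. Types: linear $L ::= X\mid M\to_cL$ ($X$ atoms); multi $M ::= [L_1,\ldots,L_n]$ (finite multisets); environments $\Gamma$ map variables to multi types with finite support, $+$ pointwise union, $\Gamma,x:M$ with $x\notin\mathrm{supp}(\Gamma)$. Rules: (ax) $x:[L]\vdash^0x:L$; (many) from $\Gamma_i\vdash^{k_i}t:L_i$ ($i\in I$ finite) infer $\sum\Gamma_i\vdash^{\sum k_i}t:[L_i]_{i\in I}$; ($\lambda$) from $\Gamma,x:M\vdash^kt:L$ infer $\Gamma\vdash^k\lambda_cx.t:M\to_cL$; (@) from $\Gamma\vdash^{k_1}t:M\to_cL$ and $\Delta\vdash^{k_2}u:M$ infer $\Gamma+\Delta\vdash^kt\cdot^du:L$,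 $k=k_1+k_2$ if $c=d$, else $k_1+k_2+1$. *)

theory Defs
  imports Main "HOL-Library.Multiset" "HOL-Library.Poly_Mapping"
begin

datatype color = White | Black

text \<open>
  Terms modulo alpha are represented by de Bruijn indices. \<open>App d t u\<close> is the
  application $t \cdot^d u$.
\<close>
datatype tm = Var nat | Lam color tm | App color tm tm

primrec lift :: "tm \<Rightarrow> nat \<Rightarrow> tm" where
  "lift (Var i) k = (if i < k then Var i else Var (i + 1))"
| "lift (Lam c t) k = Lam c (lift t (k + 1))"
| "lift (App d t u) k = App d (lift t k) (lift u k)"

text \<open>
  \<open>subst t u k\<close> replaces index \<open>k\<close> by \<open>u\<close> in \<open>t\<close> and decrements the indices
  above \<open>k\<close>, the binder of \<open>k\<close> being removed.
\<close>
primrec subst :: "tm \<Rightarrow> tm \<Rightarrow> nat \<Rightarrow> tm" where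
  "subst (Var i) u k = (if k < i then Var (i - 1) else if i = k then u else Var i)"
| "subst (Lam c t) u k = Lam c (subst t (lift u 0) (k + 1))"
| "subst (App d t s) u k = App d (subst t u k) (subst s u k)"

text \<open>
  \<open>root_step n r s\<close>: the redex \<open>r\<close> contracts to \<open>s\<close>, where \<open>n\<close> is \<open>0\<close> for a silent
  redex and \<open>1\<close> for an interaction redex.
\<close>
inductive root_step :: "nat \<Rightarrow> tm \<Rightarrow> tm \<Rightarrow> bool" where
  "root_step (if c = d then 0 else 1) (App d (Lam c t) u) (subst t u 0)"

text \<open>
  The head context with abstractions \<open>[c\<^sub>1, \<dots>, c\<^sub>n]\<close> and arguments
  \<open>[(d\<^sub>1, t\<^sub>1), \<dots>, (d\<^sub>k, t\<^sub>k)]\<close>, both listed from left to right, applied to a term.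
\<close>
definition plug :: "color list \<Rightarrow> (color \<times> tm) list \<Rightarrow> tm \<Rightarrow> tm" where
  "plug cs args t = foldr Lam cs (foldl (\<lambda>s (d, u). App d s u) t args)"

inductive head_step :: "nat \<Rightarrow> tm \<Rightarrow> tm \<Rightarrow> bool" where
  "root_step n r s \<Longrightarrow> head_step n (plug cs args r) (plug cs args s)"

definition has_head_redex :: "tm \<Rightarrow> bool" where
  "has_head_redex t \<longleftrightarrow> (\<exists>cs args c d s u. t = plug cs args (App d (Lam c s) u))"

inductive head_steps :: "nat \<Rightarrow> tm \<Rightarrow> tm \<Rightarrow> bool" where
  refl: "head_steps 0 t t"
| step: "head_step m t s \<Longrightarrow> head_steps n s u \<Longrightarrow> head_steps (m + n) t u"

definition head_terminates :: "tm \<Rightarrow> nat \<Rightarrow> bool" (infix "\<Down>" 50) where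
  "t \<Down> k \<longleftrightarrow> (\<exists>s. head_steps k t s \<and> \<not> has_head_redex s)"

datatype 'atom lty = Atom 'atom | Arr "'atom lty multiset" color "'atom lty"

type_synonym 'atom mty = "'atom lty multiset"

text \<open>
  Finitely supported maps from indices to multi types; \<open>+\<close> and \<open>\<Sum>\<close> are pointwise
  multiset union.
\<close>
type_synonym 'atom env = "nat \<Rightarrow>\<^sub>0 'atom mty"

text \<open>
  The environment $\Gamma, x : M$ below a binder: index \<open>0\<close> is the bound variable, and
  the indices of \<open>\<Gamma>\<close> are shifted by one, so that freshness of $x$ is built in.
\<close>
lift_definition env_cons :: "'atom mty \<Rightarrow> 'atom env \<Rightarrow> 'atom env"
  is "\<lambda>M \<Gamma>. case_nat M \<Gamma>"
proof -
  fix M :: "'atom mty" and \<Gamma> :: "nat \<Rightarrow> 'atom mty"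
  assume "finite {x. \<Gamma> x \<noteq> 0}"
  then have "finite (insert 0 (Suc ` {x. \<Gamma> x \<noteq> 0}))" by simp
  moreover have "{x. case_nat M \<Gamma> x \<noteq> 0} \<subseteq> insert 0 (Suc ` {x. \<Gamma> x \<noteq> 0})"
  proof
    fix x assume "x \<in> {x. case_nat M \<Gamma> x \<noteq> 0}"
    then show "x \<in> insert 0 (Suc ` {x. \<Gamma> x \<noteq> 0})" by (cases x) auto
  qed
  ultimately show "finite {x. case_nat M \<Gamma> x \<noteq> 0}" by (rule rev_finite_subset)
qed

inductive lin_typing :: "'atom env \<Rightarrow> nat \<Rightarrow> tm \<Rightarrow> 'atom lty \<Rightarrow> bool"
  and multi_typing :: "'atom env \<Rightarrow> nat \<Rightarrow> tm \<Rightarrow> 'atom mty \<Rightarrow> bool"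
where
  ax: "lin_typing (Poly_Mapping.single x {#L#}) 0 (Var x) L"
| many: "finite (I :: nat set) \<Longrightarrow> (\<And>i. i \<in> I \<Longrightarrow> lin_typing (\<Gamma> i) (k i) t (L i))
    \<Longrightarrow> multi_typing (\<Sum>i\<in>I. \<Gamma> i) (\<Sum>i\<in>I. k i) t (image_mset L (mset_set I))"
| lam: "lin_typing (env_cons M \<Gamma>) k t L \<Longrightarrow> lin_typing \<Gamma> k (Lam c t) (Arr M c L)"
| app: "lin_typing \<Gamma> k1 t (Arr M c L) \<Longrightarrow> multi_typing \<Delta> k2 u M
    \<Longrightarrow> lin_typing (\<Gamma> + \<Delta>) (if c = d then k1 + k2 else k1 + k2 + 1) (App d t u) L"

end

theory Submission
  imports Defs
begin

text \<open>
  Quantitative subject reduction and expansion hold together as an equivalence: the derivations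
  of \<open>(\<lambda>\<^sub>c x. t) \<cdot>\<^sup>d u\<close> are exactly those of \<open>t{x := u}\<close>, with one interaction
  more if \<open>c \<noteq> d\<close>, and with exactly one application rule more. The number of application
  rules therefore bounds the length of the head reduction, which gives soundness. Conversely, a
  term without head redex \<open>\<lambda>x\<^sub>1 \<dots> x\<^sub>n. y u\<^sub>1 \<dots> u\<^sub>k\<close> is typable without
  interactions by giving \<open>y\<close> a type that takes the empty multi type for each argument, and
  expansion transports this typing back along the head reduction.
\<close>

section \<open>Environments and weights\<close>

text \<open>Generalises \<open>env_cons\<close> to any index, since lifting and substitution act at
  arbitrary depth under binders.\<close>

lift_definition env_insert :: "nat \<Rightarrow> 'a mty \<Rightarrow> 'a env \<Rightarrow> 'a env"
  is "\<lambda>j M \<Gamma> i. if i < j then \<Gamma> i else if i = j then M else \<Gamma> (i - 1)"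
proof -
  fix j :: nat and M :: "'a mty" and \<Gamma> :: "nat \<Rightarrow> 'a mty"
  assume "finite {x. \<Gamma> x \<noteq> 0}"
  then have "finite (insert j ({x. \<Gamma> x \<noteq> 0} \<union> Suc ` {x. \<Gamma> x \<noteq> 0}))" by simp
  moreover have "{x. (if x < j then \<Gamma> x else if x = j then M else \<Gamma> (x - 1)) \<noteq> 0}
      \<subseteq> insert j ({x. \<Gamma> x \<noteq> 0} \<union> Suc ` {x. \<Gamma> x \<noteq> 0})"
  proof
    fix x assume "x \<in> {x. (if x < j then \<Gamma> x else if x = j then M else \<Gamma> (x - 1)) \<noteq> 0}"
    then show "x \<in> insert j ({x. \<Gamma> x \<noteq> 0} \<union> Suc ` {x. \<Gamma> x \<noteq> 0})"
      by (cases x) (auto split: if_splits)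
  qed
  ultimately show "finite {x. (if x < j then \<Gamma> x else if x = j then M else \<Gamma> (x - 1)) \<noteq> 0}"
    by (rule rev_finite_subset)
qed

lift_definition env_delete :: "nat \<Rightarrow> 'a env \<Rightarrow> 'a env"
  is "\<lambda>j \<Gamma> i. if i < j then \<Gamma> i else \<Gamma> (Suc i)"
proof -
  fix j :: nat and \<Gamma> :: "nat \<Rightarrow> 'a mty"
  assume "finite {x. \<Gamma> x \<noteq> 0}"
  then have "finite ({x. \<Gamma> x \<noteq> 0} \<union> (\<lambda>x. x - 1) ` {x. \<Gamma> x \<noteq> 0})" by simp
  moreover have "{x. (if x < j then \<Gamma> x else \<Gamma> (Suc x)) \<noteq> 0}
      \<subseteq> {x. \<Gamma> x \<noteq> 0} \<union> (\<lambda>x. x - 1) ` {x. \<Gamma> x \<noteq> 0}"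
    by (force split: if_splits)
  ultimately show "finite {x. (if x < j then \<Gamma> x else \<Gamma> (Suc x)) \<noteq> 0}"
    by (rule rev_finite_subset)
qed

lemma env_cons_eq_env_insert: "env_cons M \<Gamma> = env_insert 0 M \<Gamma>"
  by transfer (auto split: nat.splits)

lemma env_insert_delete: "env_insert j (Poly_Mapping.lookup \<Gamma> j) (env_delete j \<Gamma>) = \<Gamma>"
  by transfer (auto simp: fun_eq_iff less_Suc_eq_le)

lemma env_delete_insert: "env_delete j (env_insert j M \<Gamma>) = \<Gamma>"
  by transfer auto

lemma lookup_env_insert: "Poly_Mapping.lookup (env_insert j M \<Gamma>) j = M"
  by transfer auto

lemma env_insert_inject [simp]: "env_insert j M \<Gamma> = env_insert j N \<Delta> \<longleftrightarrow> M = N \<and> \<Gamma> = \<Delta>"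
  by (metis env_delete_insert lookup_env_insert)

lemma env_insert_add: "env_insert j (M + N) (\<Gamma> + \<Delta>) = env_insert j M \<Gamma> + env_insert j N \<Delta>"
  by transfer auto

lemma env_insert_zero: "env_insert j {#} 0 = 0"
  by transfer auto

lemma env_insert_single: "env_insert j M 0 = Poly_Mapping.single j M"
  by transfer (auto simp: when_def)

text \<open>Exchange law for crossing a binder, used with \<open>i = 0\<close>: inserting at
  \<open>i\<close> first moves position \<open>j\<close> to \<open>Suc j\<close>.\<close>

lemma env_insert_commute:
  assumes "i \<le> j"
  shows "env_insert (Suc j) N (env_insert i M \<Gamma>) = env_insert i M (env_insert j N \<Gamma>)"
  using assms by transfer (auto simp: fun_eq_iff)

text \<open>
  A weight collects the environment, the number of interactions and the number of application
  rules of a derivation.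
\<close>
datatype 'a weight = Weight (wenv: "'a env") (interactions: nat) (applications: nat)

text \<open>As a commutative monoid, weights let all three components be split and regrouped at once
  by \<open>ac_simps\<close>.\<close>

instantiation weight :: (type) comm_monoid_add
begin

definition zero_weight :: "'a weight" where
  "0 = Weight 0 0 0"

definition plus_weight :: "'a weight \<Rightarrow> 'a weight \<Rightarrow> 'a weight" where
  "v + w = Weight (wenv v + wenv w) (interactions v + interactions w)
    (applications v + applications w)"

instance
  by standard (auto simp: zero_weight_def plus_weight_def ac_simps)

end

lemma plus_Weight [simp]: "Weight \<Gamma> k m + Weight \<Delta> l n = Weight (\<Gamma> + \<Delta>) (k + l) (m + n)"
  by (simp add: plus_weight_def)

text \<open>Entering a binder is \<open>extend 0 M w\<close>, and the weight of an axiom is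
  \<open>extend x {#L#} 0\<close>.\<close>

definition extend :: "nat \<Rightarrow> 'a mty \<Rightarrow> 'a weight \<Rightarrow> 'a weight" where
  "extend j M w = Weight (env_insert j M (wenv w)) (interactions w) (applications w)"

text \<open>The price of one application rule. The final 1 is paid even when the colours agree, so
  contracting a silent redex also decreases the weight.\<close>

definition cost :: "nat \<Rightarrow> 'a weight" where
  "cost m = Weight 0 m 1"

lemma extend_inject [simp]: "extend j M v = extend j N w \<longleftrightarrow> M = N \<and> v = w"
  by (auto simp: extend_def intro: weight.expand)

lemma extend_add: "extend j (M + N) (v + w) = extend j M v + extend j N w"
  by (simp add: extend_def env_insert_add plus_weight_def)

lemma extend_add_empty: "extend j {#} (v + w) = extend j {#} v + extend j {#} w"
  using extend_add[of j "{#}" "{#}"] by simp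

lemma extend_zero [simp]: "extend j {#} 0 = 0"
  by (simp add: extend_def env_insert_zero zero_weight_def)

lemma extend_cost [simp]: "extend j {#} (cost m) = cost m"
  by (simp add: extend_def cost_def env_insert_zero)

lemma extend_add_cost: "extend j M (w + cost m) = extend j M w + cost m"
  using extend_add[of j M "{#}" w "cost m"] by simp

lemma extend_commute:
  "i \<le> j \<Longrightarrow> extend (Suc j) N (extend i M w) = extend i M (extend j N w)"
  by (simp add: extend_def env_insert_commute)

text \<open>With \<open>extend_inject\<close>, this makes \<open>extend j\<close> a bijection
  between pairs of a multi type and a weight, and weights.\<close>

lemma extend_cases:
  obtains M v where "w = extend j M v"
proof
  show "w = extend j (Poly_Mapping.lookup (wenv w) j)
      (Weight (env_delete j (wenv w)) (interactions w) (applications w))"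
    by (simp add: extend_def env_insert_delete)
qed

text \<open>Both summands are extensions by \<open>extend_cases\<close>; injectivity then compares
  the parts. This is how an application shares the types of variable \<open>j\<close> between its
  premises.\<close>

lemma extend_eq_add_iff:
  "extend j M w = v1 + v2 \<longleftrightarrow>
    (\<exists>M1 M2 w1 w2. v1 = extend j M1 w1 \<and> v2 = extend j M2 w2 \<and> M = M1 + M2 \<and> w = w1 + w2)"
proof
  assume eq: "extend j M w = v1 + v2"
  obtain M1 w1 where v1: "v1 = extend j M1 w1" by (rule extend_cases)
  obtain M2 w2 where v2: "v2 = extend j M2 w2" by (rule extend_cases)
  from eq have "extend j M w = extend j (M1 + M2) (w1 + w2)" by (simp add: v1 v2 extend_add)
  with v1 v2 show "\<exists>M1 M2 w1 w2. v1 = extend j M1 w1 \<and> v2 = extend j M2 w2 \<and>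
      M = M1 + M2 \<and> w = w1 + w2" by auto
qed (auto simp: extend_add)

lemma extend_eq_add_cost_iff:
  "extend j M w = v + cost m \<longleftrightarrow> (\<exists>w'. v = extend j M w' \<and> w = w' + cost m)"
proof
  assume eq: "extend j M w = v + cost m"
  obtain N w' where v: "v = extend j N w'" by (rule extend_cases)
  from eq have "extend j M w = extend j N (w' + cost m)" by (simp add: v extend_add_cost)
  with v show "\<exists>w'. v = extend j M w' \<and> w = w' + cost m" by auto
qed (auto simp: extend_add_cost)

lemma extend_eq_zero_iff [simp]: "extend j M w = 0 \<longleftrightarrow> M = {#} \<and> w = 0"
  by (metis extend_inject extend_zero)

lemma extend_eq_singleton_below_iff:
  assumes "i < j"
  shows "extend j M w = extend i N 0 \<longleftrightarrow> M = {#} \<and> w = extend i N 0"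
proof -
  have "extend j {#} (extend i N 0) = extend i N 0"
    \<comment> \<open>As \<open>i < j\<close>, \<open>j\<close> is the successor of
      \<open>j - 1\<close> and \<open>i\<close> is at most \<open>j - 1\<close>.\<close>
    using extend_commute[of i "j - 1" "{#}" N 0] assms by simp
  then show ?thesis by (metis extend_inject)
qed

lemma extend_eq_singleton_above_iff:
  assumes "j \<le> i"
  shows "extend j M w = extend (Suc i) N 0 \<longleftrightarrow> M = {#} \<and> w = extend i N 0"
proof -
  have "extend j {#} (extend i N 0) = extend (Suc i) N 0"
    using extend_commute[of j i N "{#}" 0] assms by simp
  then show ?thesis by (metis extend_inject)
qed

section \<open>Weighted derivations\<close>

text \<open>Adds one derivation at a time instead of using index sets, and takes the judgement as a
  parameter, so that \<open>derives\<close> can be defined by recursion on terms alone.\<close>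

inductive many_of :: "('w::comm_monoid_add \<Rightarrow> 'l \<Rightarrow> bool) \<Rightarrow> 'w \<Rightarrow> 'l multiset \<Rightarrow> bool"
  for P where
  empty: "many_of P 0 {#}"
| add: "P v L \<Longrightarrow> many_of P w M \<Longrightarrow> many_of P (v + w) (add_mset L M)"

lemma many_of_empty_iff [simp]: "many_of P w {#} \<longleftrightarrow> w = 0"
  by (auto elim: many_of.cases intro: many_of.empty)

lemma many_of_union:
  assumes "many_of P v M" and "many_of P w N"
  shows "many_of P (v + w) (M + N)"
  using assms by induction (auto simp: add.assoc intro: many_of.add)

text \<open>Induction on the family: the element added last lies in \<open>M\<close> or in
  \<open>N\<close>, and its weight goes to that side.\<close>

lemma many_of_unionE:
  assumes "many_of P w (M + N)"
  obtains w1 w2 where "w = w1 + w2" "many_of P w1 M" "many_of P w2 N"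
proof -
  have "\<exists>w1 w2. w = w1 + w2 \<and> many_of P w1 M \<and> many_of P w2 N"
    using assms
  proof (induction w "M + N" arbitrary: M N rule: many_of.induct)
    case empty
    then show ?case by (auto intro: many_of.empty)
  next
    case (add v L w K)
    have "L \<in># M + N" using add(4) by (metis union_single_eq_member)
    then consider M' where "M = add_mset L M'" | N' where "N = add_mset L N'"
      by (auto dest: multi_member_split)
    then show ?case
    proof cases
      case 1
      with add(4) have "K = M' + N" by simp
      from add(3)[OF this] obtain w1 w2
        where "w = w1 + w2" "many_of P w1 M'" "many_of P w2 N" by blast
      with 1 add(1) have "v + w = (v + w1) + w2 \<and> many_of P (v + w1) M \<and> many_of P w2 N"
        by (auto simp: add.assoc intro: many_of.add)
      then show ?thesis by blast
    next
      case 2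
      with add(4) have "K = M + N'" by simp
      from add(3)[OF this] obtain w1 w2
        where "w = w1 + w2" "many_of P w1 M" "many_of P w2 N'" by blast
      with 2 add(1) have "v + w = w1 + (v + w2) \<and> many_of P w1 M \<and> many_of P (v + w2) N"
        by (auto simp: add.left_commute intro: many_of.add)
      then show ?thesis by blast
    qed
  qed
  then show thesis using that by blast
qed

lemma many_of_union_iff:
  "many_of P w (M + N) \<longleftrightarrow> (\<exists>w1 w2. w = w1 + w2 \<and> many_of P w1 M \<and> many_of P w2 N)"
  by (blast intro: many_of_union elim: many_of_unionE)

lemma many_of_single_iff [simp]: "many_of P w {#L#} \<longleftrightarrow> P w L"
proof
  assume "many_of P w {#L#}"
  then show "P w L" by cases auto
next
  assume "P w L"
  then show "many_of P w {#L#}" using many_of.add[OF _ many_of.empty, of P w L] by simp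
qed

lemma many_of_add_mset_iff:
  "many_of P w (add_mset L M) \<longleftrightarrow> (\<exists>w1 w2. w = w1 + w2 \<and> P w1 L \<and> many_of P w2 M)"
  using many_of_union_iff[of P w "{#L#}" M] by simp

text \<open>The type system is syntax-directed, so a recursion on terms captures it and its
  equations provide inversion.\<close>

primrec derives :: "tm \<Rightarrow> 'a weight \<Rightarrow> 'a lty \<Rightarrow> bool" where
  "derives (Var x) w L \<longleftrightarrow> w = extend x {#L#} 0"
| "derives (Lam c t) w T \<longleftrightarrow> (\<exists>M L. T = Arr M c L \<and> derives t (extend 0 M w) L)"
| "derives (App d t u) w L \<longleftrightarrow>
    (\<exists>c M w1 w2. derives t w1 (Arr M c L) \<and> many_of (derives u) w2 M \<and>
      w = w1 + w2 + cost (if c = d then 0 else 1))"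

text \<open>Carries a characterisation of single derivations over to families along an additive map
  of weights, here \<open>extend j {#}\<close>.\<close>

lemma many_of_image_iff:
  assumes "f 0 = 0" and "\<And>v w. f (v + w) = f v + f w"
    and "\<And>w L. P w L \<longleftrightarrow> (\<exists>v. w = f v \<and> Q v L)"
  shows "many_of P w M \<longleftrightarrow> (\<exists>v. w = f v \<and> many_of Q v M)"
proof (induction M arbitrary: w)
  case empty
  then show ?case by (simp add: assms(1))
next
  case (add L M)
  have "many_of P w (add_mset L M) \<longleftrightarrow>
      (\<exists>v1 v2. w = f v1 + f v2 \<and> Q v1 L \<and> many_of Q v2 M)"
    unfolding many_of_add_mset_iff assms(3) add by blast
  then show ?case unfolding many_of_add_mset_iff assms(2)[symmetric] by blast
qed

text \<open>Index \<open>j\<close> does not occur in \<open>lift t j\<close>, and without weakening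
  it must get the empty multi type.\<close>

lemma derives_lift:
  fixes w :: "'a weight"
  shows "derives (lift t j) w L \<longleftrightarrow> (\<exists>v. w = extend j {#} v \<and> derives t v L)"
proof (induction t arbitrary: j w L)
  case (Var i)
  show ?case
  proof (cases "i < j")
    case True
    then show ?thesis using extend_eq_singleton_below_iff[of i j "{#}" _ "{#L#}"] by force
  next
    case False
    then show ?thesis using extend_eq_singleton_above_iff[of j i "{#}" _ "{#L#}"] by force
  qed
next
  case (Lam c t)
  have "(\<exists>v. extend 0 M w = extend (Suc j) {#} v \<and> derives t v K) \<longleftrightarrow>
      (\<exists>v. w = extend j {#} v \<and> derives t (extend 0 M v) K)" for M K
  proof -
    \<comment> \<open>Once \<open>w\<close> is an extension at \<open>j\<close>, the insertions at 0
      and \<open>Suc j\<close> can be exchanged.\<close>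
    obtain N v where w: "w = extend j N v" by (rule extend_cases)
    show ?thesis by (auto simp: w extend_commute[of 0 j, symmetric])
  qed
  then show ?case by (auto simp: Lam)
next
  case (App d t u)
  have many: "many_of (derives (lift u j)) w M \<longleftrightarrow>
      (\<exists>v. w = extend j {#} v \<and> many_of (derives u) v M)" for w :: "'a weight" and M
    by (rule many_of_image_iff) (auto simp: extend_add_empty App)
  show ?case
  proof
    assume "derives (lift (App d t u) j) w L"
    then obtain c M v1 v2 where "derives t v1 (Arr M c L)" "many_of (derives u) v2 M"
      "w = extend j {#} v1 + extend j {#} v2 + cost (if c = d then 0 else 1)"
      by (auto simp only: lift.simps derives.simps many App)
    moreover from this have "w = extend j {#} (v1 + v2 + cost (if c = d then 0 else 1))"
      by (simp add: extend_add_empty)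
    ultimately show "\<exists>v. w = extend j {#} v \<and> derives (App d t u) v L"
      unfolding derives.simps by blast
  next
    assume "\<exists>v. w = extend j {#} v \<and> derives (App d t u) v L"
    then obtain c M v1 v2 where "derives t v1 (Arr M c L)" "many_of (derives u) v2 M"
      "w = extend j {#} v1 + extend j {#} v2 + cost (if c = d then 0 else 1)"
      by (auto simp only: derives.simps extend_add_empty extend_cost)
    then show "derives (lift (App d t u) j) w L"
      unfolding lift.simps derives.simps many App by blast
  qed
qed

lemma many_of_derives_lift:
  "many_of (derives (lift t j)) w M \<longleftrightarrow>
    (\<exists>v. w = extend j {#} v \<and> many_of (derives t) v M)"
  by (rule many_of_image_iff) (auto simp: extend_add_empty derives_lift)

text \<open>Passes the substitution equivalence to families. Forwards, the multi types consumed by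
  the members add up; backwards, their decomposition dictates how the derivations of
  \<open>R\<close> are distributed.\<close>

lemma many_of_subst:
  assumes "\<And>w L. P w L \<longleftrightarrow>
      (\<exists>M w1 w2. Q (extend j M w1) L \<and> many_of R w2 M \<and> w = w1 + w2)"
  shows "many_of P w N \<longleftrightarrow>
      (\<exists>M w1 w2. many_of Q (extend j M w1) N \<and> many_of R w2 M \<and> w = w1 + w2)"
proof (induction N arbitrary: w)
  case empty
  show ?case by simp
next
  case (add L N)
  show ?case
  proof
    assume "many_of P w (add_mset L N)"
    then obtain M1 v1 v2 M2 w1 w2 where
      "Q (extend j M1 v1) L" "many_of R v2 M1" "many_of Q (extend j M2 w1) N" "many_of R w2 M2"
      and w: "w = (v1 + v2) + (w1 + w2)"
      unfolding many_of_add_mset_iff assms add by blast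
    then have "many_of Q (extend j (M1 + M2) (v1 + w1)) (add_mset L N)"
      "many_of R (v2 + w2) (M1 + M2)"
      by (auto simp: extend_add intro: many_of.add many_of_union)
    moreover have "w = (v1 + w1) + (v2 + w2)" using w by (simp add: ac_simps)
    ultimately show "\<exists>M w1 w2. many_of Q (extend j M w1) (add_mset L N) \<and>
        many_of R w2 M \<and> w = w1 + w2" by blast
  next
    assume "\<exists>M w1 w2. many_of Q (extend j M w1) (add_mset L N) \<and>
        many_of R w2 M \<and> w = w1 + w2"
    then obtain M1 v1 v' M2 w1 where
      "Q (extend j M1 v1) L" "many_of R v' (M1 + M2)" "many_of Q (extend j M2 w1) N"
      "w = (v1 + w1) + v'"
      unfolding many_of_add_mset_iff extend_eq_add_iff by blast
    moreover from this obtain v2 w2 where "many_of R v2 M1" "many_of R w2 M2" "v' = v2 + w2"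
      unfolding many_of_union_iff by blast
    ultimately have "P (v1 + v2) L" "many_of P (w1 + w2) N" and w: "w = (v1 + w1) + (v2 + w2)"
      unfolding assms add by blast+
    moreover have "w = (v1 + v2) + (w1 + w2)" using w by (simp add: ac_simps)
    ultimately show "many_of P w (add_mset L N)" by (metis many_of.add)
  qed
qed

text \<open>Substitution and anti-substitution together: each axiom on index \<open>j\<close> is
  exchanged for a derivation of \<open>u\<close> of the same type. \<open>M\<close> collects these
  types, and no application rule is gained or lost.\<close>

lemma derives_subst:
  fixes w :: "'a weight"
  shows "derives (subst t u j) w L \<longleftrightarrow>
    (\<exists>M w1 w2. derives t (extend j M w1) L \<and> many_of (derives u) w2 M \<and> w = w1 + w2)"
proof (induction t arbitrary: u j w L)
  case (Var i)
  consider "i < j" | "i = j" | "j < i" by linarith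
  then show ?case
  proof cases
    case 1
    then show ?thesis by (simp add: extend_eq_singleton_below_iff)
  next
    case 2
    then show ?thesis by simp
  next
    case 3
    then obtain i' where "i = Suc i'" "j \<le> i'" by (cases i) auto
    then show ?thesis by (simp add: extend_eq_singleton_above_iff)
  qed
next
  case (Lam c t)
  have body: "derives (subst t (lift u 0) (Suc j)) (extend 0 N w) K \<longleftrightarrow>
      (\<exists>M w1 w2. derives t (extend 0 N (extend j M w1)) K \<and>
        many_of (derives u) w2 M \<and> w = w1 + w2)" for N K
  proof -
    have "derives (subst t (lift u 0) (Suc j)) (extend 0 N w) K \<longleftrightarrow>
        (\<exists>M v1 w2. derives t (extend (Suc j) M v1) K \<and> many_of (derives u) w2 M \<and>
          extend 0 N w = v1 + extend 0 {#} w2)"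
      unfolding Lam many_of_derives_lift by blast
    \<comment> \<open>The summand \<open>extend 0 {#} w2\<close> is empty at 0, so all of
      \<open>N\<close> comes from \<open>v1\<close>, which is thus
      \<open>extend 0 N w1\<close>.\<close>
    also have "\<dots> \<longleftrightarrow> (\<exists>M w1 w2. derives t (extend (Suc j) M (extend 0 N w1)) K \<and>
        many_of (derives u) w2 M \<and> w = w1 + w2)"
      by (simp add: extend_eq_add_iff) blast
    finally show ?thesis by (simp add: extend_commute)
  qed
  show ?case
    by (simp only: subst.simps derives.simps body Suc_eq_plus1[symmetric]) blast
next
  case (App d t s)
  have many: "many_of (derives (subst s u j)) w N \<longleftrightarrow>
      (\<exists>M w1 w2. many_of (derives s) (extend j M w1) N \<and> many_of (derives u) w2 M \<and>
        w = w1 + w2)" for w :: "'a weight" and N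
    by (rule many_of_subst) (rule App)
  show ?case
  proof
    assume "derives (subst (App d t s) u j) w L"
    then obtain c N M1 v1 v2 M2 w1 w2 where
      *: "derives t (extend j M1 v1) (Arr N c L)" "many_of (derives u) v2 M1"
        "many_of (derives s) (extend j M2 w1) N" "many_of (derives u) w2 M2"
      and w: "w = (v1 + v2) + (w1 + w2) + cost (if c = d then 0 else 1)"
      unfolding subst.simps derives.simps many App by blast
    \<comment> \<open>The share of \<open>t\<close> and \<open>s\<close> together with the
      application; what is left over, \<open>v2 + w2\<close>, belongs to \<open>u\<close>.\<close>
    let ?w = "v1 + w1 + cost (if c = d then 0 else 1)"
    have "derives (App d t s) (extend j (M1 + M2) ?w) L"
      unfolding derives.simps extend_add_cost extend_add using *(1,3) by blast
    moreover have "many_of (derives u) (v2 + w2) (M1 + M2)" using *(2,4) by (rule many_of_union)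
    moreover have "w = ?w + (v2 + w2)" using w by (simp add: ac_simps)
    ultimately show "\<exists>M w1 w2. derives (App d t s) (extend j M w1) L \<and>
        many_of (derives u) w2 M \<and> w = w1 + w2" by blast
  next
    assume "\<exists>M w1 w2. derives (App d t s) (extend j M w1) L \<and>
        many_of (derives u) w2 M \<and> w = w1 + w2"
    then obtain c N M w' v w1 w2 where
      "derives t w1 (Arr N c L)" "many_of (derives s) w2 N" "many_of (derives u) v M"
      "extend j M w' = w1 + w2" "w = w' + cost (if c = d then 0 else 1) + v"
      unfolding derives.simps extend_eq_add_cost_iff by metis
    \<comment> \<open>Splitting the extension between the premises splits \<open>M\<close> into
      \<open>M1 + M2\<close>, which then splits the family for \<open>u\<close>.\<close>
    then obtain M1 v1 M2 w1 where
      "derives t (extend j M1 v1) (Arr N c L)" "many_of (derives u) v (M1 + M2)"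
      "many_of (derives s) (extend j M2 w1) N"
      "w = (v1 + w1 + cost (if c = d then 0 else 1)) + v"
      unfolding extend_eq_add_iff by blast
    moreover from this obtain v2 w2 where
      "many_of (derives u) v2 M1" "many_of (derives u) w2 M2" "v = v2 + w2"
      unfolding many_of_union_iff by blast
    moreover from calculation have
      "w = (v1 + v2) + (w1 + w2) + cost (if c = d then 0 else 1)"
      by (simp add: ac_simps)
    ultimately show "derives (subst (App d t s) u j) w L"
      unfolding subst.simps derives.simps many App by blast
  qed
qed

section \<open>Head reduction\<close>

text \<open>Left to right this is subject reduction, right to left subject expansion. The
  \<open>itself\<close> argument fixes the type of atoms, which otherwise occurs only under the
  quantifiers.\<close>

definition derives_cost :: "'a itself \<Rightarrow> nat \<Rightarrow> tm \<Rightarrow> tm \<Rightarrow> bool" where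
  "derives_cost _ m t s \<longleftrightarrow>
    (\<forall>(w :: 'a weight) L. derives t w L \<longleftrightarrow> (\<exists>v. w = v + cost m \<and> derives s v L))"

text \<open>The abstraction forces the colour of the arrow to be its own, so the application costs
  exactly \<open>cost m\<close>; what remains is the right-hand side of \<open>derives_subst\<close>
  at index 0.\<close>

lemma derives_cost_root_step:
  assumes "root_step m r s"
  shows "derives_cost TYPE('a) m r s"
  using assms
proof cases
  case (1 c d t u)
  show ?thesis unfolding derives_cost_def 1 derives_subst by auto
qed

lemma derives_cost_Lam:
  assumes "derives_cost TYPE('a) m t s"
  shows "derives_cost TYPE('a) m (Lam c t) (Lam c s)"
proof -
  have "derives t (extend 0 M w) L \<longleftrightarrow>
      (\<exists>v. w = v + cost m \<and> derives s (extend 0 M v) L)" for w :: "'a weight" and M L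
    using assms unfolding derives_cost_def by (auto simp: extend_eq_add_cost_iff)
  then show ?thesis unfolding derives_cost_def derives.simps by blast
qed

lemma derives_cost_App:
  assumes "derives_cost TYPE('a) m t s"
  shows "derives_cost TYPE('a) m (App d t u) (App d s u)"
  unfolding derives_cost_def
proof (intro allI iffI)
  fix w :: "'a weight" and L
  assume "derives (App d t u) w L"
  then obtain c M v w2 where "derives s v (Arr M c L)" "many_of (derives u) w2 M"
    "w = v + cost m + w2 + cost (if c = d then 0 else 1)"
    using assms unfolding derives_cost_def by auto
  moreover from this have "w = (v + w2 + cost (if c = d then 0 else 1)) + cost m"
    by (simp add: ac_simps)
  ultimately show "\<exists>v. w = v + cost m \<and> derives (App d s u) v L"
    unfolding derives.simps by blast
next
  fix w :: "'a weight" and L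
  assume "\<exists>v. w = v + cost m \<and> derives (App d s u) v L"
  then obtain c M v w2 where *: "derives s v (Arr M c L)" "many_of (derives u) w2 M"
    "w = v + w2 + cost (if c = d then 0 else 1) + cost m"
    by auto
  have "derives t (v + cost m) (Arr M c L)" using assms *(1) unfolding derives_cost_def by blast
  moreover have "w = (v + cost m) + w2 + cost (if c = d then 0 else 1)"
    using *(3) by (simp add: ac_simps)
  ultimately show "derives (App d t u) w L" unfolding derives.simps using *(2) by blast
qed

lemma derives_cost_head_step:
  assumes "head_step m t s"
  shows "derives_cost TYPE('a) m t s"
  using assms
proof cases
  case (1 r r' cs args)
  have "derives_cost TYPE('a) m (foldl (\<lambda>s (d, u). App d s u) r args)
      (foldl (\<lambda>s (d, u). App d s u) r' args)"
    using derives_cost_root_step[OF 1(3)]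
    \<comment> \<open>\<open>foldl\<close> puts the first argument around the hole first, so the
      hole changes along the induction.\<close>
    by (induction args arbitrary: r r') (auto intro: derives_cost_App)
  then have "derives_cost TYPE('a) m (plug cs args r) (plug cs args r')"
    unfolding plug_def by (induction cs) (auto intro: derives_cost_Lam)
  with 1 show ?thesis by simp
qed

lemma derives_head_terminates:
  fixes \<Gamma> :: "'a env"
  assumes "derives t (Weight \<Gamma> k n) L"
  shows "\<exists>k'\<le>k. t \<Down> k'"
  using assms
proof (induction n arbitrary: t k rule: less_induct)
  case (less n)
  show ?case
  proof (cases "has_head_redex t")
    case False
    \<comment> \<open>Zero steps are taken here. Interactions still counted in \<open>k\<close> are
      never performed, hence only an inequality.\<close>
    then show ?thesis unfolding head_terminates_def using head_steps.refl by blast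
  next
    case True
    then obtain cs args c d r u where t: "t = plug cs args (App d (Lam c r) u)"
      unfolding has_head_redex_def by blast
    have "head_step (if c = d then 0 else 1) t (plug cs args (subst r u 0))"
      unfolding t by (rule head_step.intros[OF root_step.intros])
    then obtain m s where step: "head_step m t s" by blast
    from derives_cost_head_step[OF this, where 'a = 'a] less.prems
    obtain \<Delta> k1 n1 where "Weight \<Gamma> k n = Weight \<Delta> k1 n1 + cost m" "derives s (Weight \<Delta> k1 n1) L"
      unfolding derives_cost_def by (metis weight.exhaust)
    \<comment> \<open>\<open>cost m\<close> has empty environment and application count 1: the
      environment is kept and the induction measure drops.\<close>
    then have "k = k1 + m" "n1 < n" "derives s (Weight \<Gamma> k1 n1) L" by (auto simp: cost_def)
    then obtain k' where "k' \<le> k1" "s \<Down> k'" using less.IH by blast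
    then have "t \<Down> (m + k')"
      unfolding head_terminates_def using step head_steps.step by blast
    then show ?thesis using \<open>k' \<le> k1\<close> \<open>k = k1 + m\<close> by (intro exI[of _ "m + k'"]) simp
  qed
qed

section \<open>Typability of terms without head redex\<close>

lemma has_head_redex_Lam:
  assumes "has_head_redex t"
  shows "has_head_redex (Lam c t)"
proof -
  from assms obtain cs args c' d s u where "t = plug cs args (App d (Lam c' s) u)"
    unfolding has_head_redex_def by blast
  then have "Lam c t = plug (c # cs) args (App d (Lam c' s) u)" by (simp add: plug_def)
  then show ?thesis unfolding has_head_redex_def by blast
qed

lemma has_head_redex_beta: "has_head_redex (App d (Lam c s) u)"
proof -
  have "App d (Lam c s) u = plug [] [] (App d (Lam c s) u)" by (simp add: plug_def)
  then show ?thesis unfolding has_head_redex_def by blast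
qed

lemma has_head_redex_App:
  assumes "has_head_redex t"
  shows "has_head_redex (App d t u)"
proof -
  from assms obtain cs args c d' s u' where t: "t = plug cs args (App d' (Lam c s) u')"
    unfolding has_head_redex_def by blast
  show ?thesis
  proof (cases cs)
    case Nil
    then have "App d t u = plug [] (args @ [(d, u)]) (App d' (Lam c s) u')"
      by (simp add: t plug_def)
    then show ?thesis unfolding has_head_redex_def by blast
  next
    case (Cons c' cs')
    \<comment> \<open>With a leading abstraction, \<open>t\<close> is itself an abstraction, so
      applying it creates a redex at the root.\<close>
    then show ?thesis by (simp add: t plug_def has_head_redex_beta)
  qed
qed

text \<open>
  Under an application, the function part may be given any type: this is the generalisation that
  the induction needs.
\<close>
lemma derives_head_normal:
  assumes "\<not> has_head_redex t"
  shows "(\<exists>(\<Gamma> :: 'a env) n L. derives t (Weight \<Gamma> 0 n) L) \<and>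
    ((\<forall>c s. t \<noteq> Lam c s) \<longrightarrow> (\<forall>L. \<exists>(\<Gamma> :: 'a env) n. derives t (Weight \<Gamma> 0 n) L))"
  using assms
proof (induction t)
  case (Var x)
  have "derives (Var x) (Weight (env_insert x {#L#} (0 :: 'a env)) 0 0) L" for L
    by (simp add: extend_def zero_weight_def)
  then show ?case by blast
next
  case (Lam c t)
  then obtain \<Gamma> :: "'a env" and n L where *: "derives t (Weight \<Gamma> 0 n) L"
    using has_head_redex_Lam by blast
  \<comment> \<open>\<open>M\<close> is whatever multi type \<open>\<Gamma>\<close> gives to index
    0.\<close>
  obtain M v where v: "Weight \<Gamma> 0 n = extend 0 M v" by (rule extend_cases)
  then obtain \<Delta> where "v = Weight \<Delta> 0 n" by (cases v) (auto simp: extend_def)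
  with * v have "derives (Lam c t) (Weight \<Delta> 0 n) (Arr M c L)" by simp
  then show ?case by blast
next
  case (App d t u)
  then have "\<not> has_head_redex t" "\<forall>c s. t \<noteq> Lam c s"
    using has_head_redex_App has_head_redex_beta by blast+
  \<comment> \<open>The arrow gets the colour \<open>d\<close> of the application, avoiding an
    interaction, and the empty multi type as source, leaving \<open>u\<close> untyped at weight
    0.\<close>
  then have "\<exists>(\<Gamma> :: 'a env) n. derives t (Weight \<Gamma> 0 n) (Arr {#} d L)" for L
    using App.IH by blast
  moreover have "derives (App d t u) (Weight \<Gamma> 0 (Suc n)) L"
    if "derives t (Weight \<Gamma> 0 n) (Arr {#} d L)" for \<Gamma> :: "'a env" and n L
    unfolding derives.simps
    using that by (intro exI[of _ d] exI[of _ "{#}"] exI[of _ "Weight \<Gamma> 0 n"] exI[of _ 0])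
      (simp add: cost_def)
  ultimately show ?case by blast
qed

text \<open>Starting from an interaction-free typing of the normal form, each step undone adds
  exactly its own count, so the total is exactly \<open>k\<close>.\<close>

lemma head_terminates_derives:
  assumes "t \<Down> k"
  shows "\<exists>(\<Gamma> :: 'a env) n L. derives t (Weight \<Gamma> k n) L"
proof -
  from assms obtain s where "head_steps k t s" "\<not> has_head_redex s"
    unfolding head_terminates_def by blast
  then show ?thesis
  proof induction
    case (refl t)
    then show ?case using derives_head_normal by blast
  next
    case (step m t s n u)
    then obtain \<Gamma> :: "'a env" and l L where "derives s (Weight \<Gamma> n l) L" by blast
    then have "derives t (Weight \<Gamma> n l + cost m) L"
      using derives_cost_head_step[OF step(1), where 'a = 'a] unfolding derives_cost_def by blast
    then show ?case by (auto simp: cost_def add.commute)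
  qed
qed

section \<open>Weighted derivations and the type system\<close>

lemma many_of_sum:
  assumes "finite I" and "\<And>i. i \<in> I \<Longrightarrow> P (w i) (L i)"
  shows "many_of P (\<Sum>i\<in>I. w i) (image_mset L (mset_set I))"
  using assms by induction (auto intro: many_of.add)

text \<open>The existential \<open>n\<close> supplies the number of application rules, which the
  typing judgement does not record.\<close>

lemma typing_imp_derives:
  "lin_typing \<Gamma> k t L \<Longrightarrow> \<exists>n. derives t (Weight \<Gamma> k n) L"
  "multi_typing \<Gamma> k t M \<Longrightarrow> \<exists>n. many_of (derives t) (Weight \<Gamma> k n) M"
proof (induction rule: lin_typing_multi_typing.inducts)
  case (ax x L)
  show ?case by (simp add: extend_def env_insert_single zero_weight_def)
next
  case (many I \<Gamma> k t L)
  then obtain n where "\<And>i. i \<in> I \<Longrightarrow> derives t (Weight (\<Gamma> i) (k i) (n i)) (L i)" by metis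
  then have "many_of (derives t) (\<Sum>i\<in>I. Weight (\<Gamma> i) (k i) (n i)) (image_mset L (mset_set I))"
    by (intro many_of_sum many(1))
  moreover have "(\<Sum>i\<in>I. Weight (\<Gamma> i) (k i) (n i)) =
      Weight (\<Sum>i\<in>I. \<Gamma> i) (\<Sum>i\<in>I. k i) (\<Sum>i\<in>I. n i)"
    using many(1) by (induction) (auto simp: zero_weight_def)
  ultimately show ?case by auto
next
  case (lam M \<Gamma> k t L c)
  then show ?case by (auto simp: extend_def env_cons_eq_env_insert)
next
  case (app \<Gamma> k1 t M c L \<Delta> k2 u d)
  then obtain n1 n2 where
    "derives t (Weight \<Gamma> k1 n1) (Arr M c L)" "many_of (derives u) (Weight \<Delta> k2 n2) M" by blast
  then have "derives (App d t u)
      (Weight \<Gamma> k1 n1 + Weight \<Delta> k2 n2 + cost (if c = d then 0 else 1)) L"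
    unfolding derives.simps by blast
  moreover have "Weight \<Gamma> k1 n1 + Weight \<Delta> k2 n2 + cost (if c = d then 0 else 1) =
      Weight (\<Gamma> + \<Delta>) (if c = d then k1 + k2 else k1 + k2 + 1) (n1 + n2 + 1)"
    by (simp add: cost_def)
  ultimately show ?case by metis
qed

lemma multi_typing_empty: "multi_typing 0 0 t {#}"
  using many[of "{}"] by simp

lemma multi_typing_add_mset:
  assumes "lin_typing \<Gamma> k t L" and "multi_typing \<Delta> l t M"
  shows "multi_typing (\<Gamma> + \<Delta>) (k + l) t (add_mset L M)"
  using assms(2)
proof cases
  case (many I \<Gamma>s ks Ls)
  \<comment> \<open>A fresh index for the additional derivation exists because \<open>I\<close> is
    finite; updating the families at \<open>j\<close> leaves their values on \<open>I\<close>
    intact.\<close>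
  obtain j where j: "j \<notin> I" using many(4) ex_new_if_finite infinite_UNIV_nat by blast
  have eq: "(\<Sum>i\<in>I. (\<Gamma>s(j := \<Gamma>)) i) = \<Delta>" "(\<Sum>i\<in>I. (ks(j := k)) i) = l"
    "image_mset (Ls(j := L)) (mset_set I) = M"
    using j many by (auto intro!: sum.cong image_mset_cong)
  have "multi_typing (\<Sum>i\<in>insert j I. (\<Gamma>s(j := \<Gamma>)) i) (\<Sum>i\<in>insert j I. (ks(j := k)) i) t
      (image_mset (Ls(j := L)) (mset_set (insert j I)))"
    using many assms(1) by (intro lin_typing_multi_typing.many) auto
  then show ?thesis using j many(4) eq by simp
qed

lemma derives_imp_typing:
  "derives t (Weight \<Gamma> k n) L \<Longrightarrow> lin_typing \<Gamma> k t L"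
proof (induction t arbitrary: \<Gamma> k n L)
  case (Var x)
  then show ?case by (auto simp: extend_def env_insert_single zero_weight_def intro: ax)
next
  case (Lam c t)
  then show ?case by (auto simp: extend_def env_cons_eq_env_insert[symmetric] intro: lam)
next
  case (App d t u)
  from App.prems obtain c M \<Gamma>1 k1 n1 \<Gamma>2 k2 n2 where
    t: "derives t (Weight \<Gamma>1 k1 n1) (Arr M c L)" and
    u: "many_of (derives u) (Weight \<Gamma>2 k2 n2) M" and
    eq: "\<Gamma> = \<Gamma>1 + \<Gamma>2" "k = (if c = d then k1 + k2 else k1 + k2 + 1)"
    unfolding derives.simps
  proof (elim exE conjE)
    fix c M w1 w2
    assume "derives t w1 (Arr M c L)" "many_of (derives u) w2 M"
      "Weight \<Gamma> k n = w1 + w2 + cost (if c = d then 0 else 1)"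
    then show thesis
      by (intro that[of "wenv w1" "interactions w1" "applications w1" M c
            "wenv w2" "interactions w2" "applications w2"])
        (auto simp: cost_def plus_weight_def)
  qed
  \<comment> \<open>An inner induction rebuilds the rule \<open>many\<close> member by member; the
    hypothesis for \<open>u\<close> types each member.\<close>
  have "multi_typing (wenv w) (interactions w) u M" if "many_of (derives u) w M" for w
    using that
  proof induction
    case empty
    show ?case by (simp add: zero_weight_def multi_typing_empty)
  next
    case (add v L w M)
    then show ?case by (cases v; cases w) (auto intro: multi_typing_add_mset App.IH(2))
  qed
  from this[OF u] have "multi_typing \<Gamma>2 k2 u M" by simp
  with App.IH(1)[OF t] show ?case unfolding eq by (rule app)
qed

theorem theorem2:
  fixes t :: tm
  shows "(\<forall>(\<Gamma> :: 'atom env) k L. lin_typing \<Gamma> k t L \<longrightarrow> (\<exists>k'\<le>k. t \<Down> k')) \<and>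
    (\<forall>k. t \<Down> k \<longrightarrow> (\<exists>(\<Gamma> :: 'atom env) L. lin_typing \<Gamma> k t L))"
proof (intro conjI allI impI)
  fix \<Gamma> :: "'atom env" and k L
  assume "lin_typing \<Gamma> k t L"
  then obtain n where "derives t (Weight \<Gamma> k n) L" using typing_imp_derives(1) by blast
  then show "\<exists>k'\<le>k. t \<Down> k'" by (rule derives_head_terminates)
next
  fix k
  assume "t \<Down> k"
  then obtain \<Gamma> :: "'atom env" and n L where "derives t (Weight \<Gamma> k n) L"
    using head_terminates_derives by blast
  then show "\<exists>(\<Gamma> :: 'atom env) L. lin_typing \<Gamma> k t L" using derives_imp_typing by blast
qed

end
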